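(* Let $f\in\mathcal{S}^*(1/2)$, that is, $f$ is analytic in $\mathbb{D}=\{z\in\mathbb{C}:|z|<1\}$ with $f(0)=0$, $f'(0)=1$, and $\operatorname{Re}\left(\frac{zf'(z)}{f(z)}\right)>\frac12$ for all $z\in\mathbb{D}$. Let $f^{-1}$ be the inverse function of $f$ in a neighborhood of the origin, with Taylor expansion $f^{-1}(w)=w+A_2w^2+A_3w^3+A_4w^4+A_5w^5+\cdots$, and let $$H_3(1)(f^{-1})=\begin{vmatrix} 1 & A_2 & A_3 \\ A_2 & A_3 & A_4 \\ A_3 & A_4 & A_5 \end{vmatrix}.$$ Then $$|H_3(1)(f^{-1})|\le\frac19.$$ The result is sharp: the function $$f_0(z)=\frac{z}{(1-z^3)^{1/3}}$$ belongs to $\mathcal{S}^*(1/2)$ and satisfies $|H_3(1)(f_0^{-1})|=\frac19$.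
   Context: $\mathcal{A}$ denotes the family of analytic functions $f$ on the open unit disc $\mathbb{D}$ of the form $f(z)=z+\sum_{n\ge2}a_nz^n$. The class $\mathcal{S}^*(1/2)$ of starlike functions of order $1/2$ is the set of $f\in\mathcal{A}$ with $\operatorname{Re}(zf'(z)/f(z))>1/2$ for all $z\in\mathbb{D}$ (the quotient $zf'(z)/f(z)$ takes the value $1$ at $z=0$). The third Hankel determinant of a function $z+\sum_{n\ge 2}a_nz^n$ is the determinant $H_3(1)$ of the $3\times3$ matrix with rows $(a_1,a_2,a_3)$, $(a_2,a_3,a_4)$, $(a_3,a_4,a_5)$, where $a_1=1$; $H_3(1)(f^{-1})$ is this determinant formed from the Taylor coefficients $A_n$ (with $A_1=1$) at the origin of the local inverse of $f$, which is defined near $0$ and satisfies $f(f^{-1}(w))=w$. In $f_0$, the power $(1-z^3)^{1/3}$ is the principal branch, equal to $1$ at $z=0$. *)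

theory Defs
  imports "HOL-Complex_Analysis.Complex_Analysis"
begin

definition class_A :: "(complex \<Rightarrow> complex) set" where
  "class_A = {f. f holomorphic_on ball 0 1 \<and> f 0 = 0 \<and> deriv f 0 = 1}"

text \<open>
  The quotient \<open>z f'(z) / f(z)\<close> has a removable singularity at \<open>0\<close> with value \<open>1\<close>, so the
  condition at \<open>0\<close> is automatic. The conjunct \<open>f z \<noteq> 0\<close> says that the quotient is defined.
\<close>
definition starlike_half :: "(complex \<Rightarrow> complex) set" where
  "starlike_half = {f \<in> class_A. \<forall>z \<in> ball 0 1 - {0}. f z \<noteq> 0 \<and> Re (z * deriv f z / f z) > 1/2}"

text \<open>
  The condition \<open>g w \<in> ball 0 1\<close> keeps \<open>g\<close> inside the disc on which \<open>f\<close> is given; values of the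
  total function \<open>f\<close> outside the disc are irrelevant.
\<close>
definition is_local_inverse :: "(complex \<Rightarrow> complex) \<Rightarrow> (complex \<Rightarrow> complex) \<Rightarrow> bool" where
  "is_local_inverse f g \<longleftrightarrow>
     (\<exists>r>0. g holomorphic_on ball 0 r \<and> g 0 = 0 \<and>
            (\<forall>w \<in> ball 0 r. g w \<in> ball 0 1 \<and> f (g w) = w))"

text \<open>
  A local inverse is determined only as a germ at \<open>0\<close>. The lemmas below show that it exists on
  \<open>class_A\<close> and that its Taylor coefficients do not depend on the choice.
\<close>
definition local_inverse :: "(complex \<Rightarrow> complex) \<Rightarrow> complex \<Rightarrow> complex" where
  "local_inverse f = (SOME g. is_local_inverse f g)"

definition taylor_coeff :: "(complex \<Rightarrow> complex) \<Rightarrow> nat \<Rightarrow> complex" where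
  "taylor_coeff g n = fps_nth (fps_expansion g 0) n"

definition hankel3 :: "(complex \<Rightarrow> complex) \<Rightarrow> complex" where
  "hankel3 g = (let a = taylor_coeff g in
     det (vector [vector [a 1, a 2, a 3],
                  vector [a 2, a 3, a 4],
                  vector [a 3, a 4, a 5]] :: complex ^ 3 ^ 3))"

lemma is_local_inverse_exists:
  assumes "f \<in> class_A"
  shows "\<exists>g. is_local_inverse f g"
proof -
  have hol: "f holomorphic_on ball 0 1" and f0: "f 0 = 0" and d: "deriv f 0 \<noteq> 0"
    using assms by (auto simp: class_A_def)
  obtain r where r: "r > 0" "ball 0 r \<subseteq> ball (0::complex) 1" "open (f ` ball 0 r)" "inj_on f (ball 0 r)"
    using has_complex_derivative_locally_invertible[OF hol _ _ d] by auto
  obtain g where g: "g holomorphic_on (f ` ball 0 r)" "\<And>z. z \<in> ball 0 r \<Longrightarrow> g (f z) = z"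
    using holomorphic_has_inverse[OF holomorphic_on_subset[OF hol r(2)] open_ball r(4)] by metis
  have "0 \<in> f ` ball 0 r" using f0 r(1) by force
  then obtain s where s: "s > 0" "ball 0 s \<subseteq> f ` ball 0 r"
    using r(3) openE by blast
  have "is_local_inverse f g"
    unfolding is_local_inverse_def
  proof (intro exI[of _ s] conjI ballI)
    show "g holomorphic_on ball 0 s" using g(1) s(2) holomorphic_on_subset by blast
    show "g 0 = 0" using g(2)[of 0] f0 r(1) by simp
    fix w :: complex assume "w \<in> ball 0 s"
    then obtain z where z: "z \<in> ball 0 r" "w = f z" using s(2) by blast
    show "g w \<in> ball 0 1" using z g(2) r(2) by auto
    show "f (g w) = w" using z g(2) by auto
  qed (use s in auto)
  then show ?thesis by blast
qed

lemma is_local_inverse_local_inverse: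
  assumes "f \<in> class_A"
  shows "is_local_inverse f (local_inverse f)"
  unfolding local_inverse_def using is_local_inverse_exists[OF assms] by (rule someI_ex)

lemma is_local_inverse_unique:
  assumes f: "f \<in> class_A" and g: "is_local_inverse f g" and h: "is_local_inverse f h"
  shows "eventually (\<lambda>w. g w = h w) (nhds 0)"
proof -
  have hol: "f holomorphic_on ball 0 1" and d: "deriv f 0 \<noteq> 0"
    using f by (auto simp: class_A_def)
  obtain r where r: "r > 0" "inj_on f (ball 0 r)"
    using has_complex_derivative_locally_injective[OF hol _ _ d] by auto
  have *: "eventually (\<lambda>w. k w \<in> ball 0 r \<and> f (k w) = w) (nhds 0)"
    if k: "is_local_inverse f k" for k
  proof -
    obtain s where s: "s > 0" "k holomorphic_on ball 0 s" "k 0 = 0"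
        "\<And>w. w \<in> ball 0 s \<Longrightarrow> f (k w) = w"
      using k unfolding is_local_inverse_def by blast
    have "isCont k 0"
      using holomorphic_on_imp_continuous_on[OF s(2)] s(1)
      by (simp add: continuous_on_eq_continuous_at)
    then have "filterlim k (nhds 0) (nhds 0)"
      using s(3) by (metis isCont_def tendsto_at_iff_tendsto_nhds)
    then have 1: "eventually (\<lambda>w. k w \<in> ball 0 r) (nhds 0)"
      using r(1) topological_tendstoD[of k 0 "nhds 0" "ball 0 r"] by simp
    have 2: "eventually (\<lambda>w. w \<in> ball 0 s) (nhds (0::complex))"
      using s(1) by (intro eventually_nhds_in_open) auto
    show ?thesis using 1 2 by eventually_elim (use s(4) in auto)
  qed
  show ?thesis using *[OF g] *[OF h]
    by eventually_elim (metis r(2) inj_onD)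
qed

lemma taylor_coeff_local_inverse:
  assumes "f \<in> class_A" "is_local_inverse f g"
  shows "taylor_coeff (local_inverse f) n = taylor_coeff g n"
  unfolding taylor_coeff_def
  using fps_expansion_cong[OF is_local_inverse_unique[OF assms(1) is_local_inverse_local_inverse[OF assms(1)] assms(2)]]
  by simp

lemma taylor_coeff_local_inverse_1:
  assumes "f \<in> class_A"
  shows "taylor_coeff (local_inverse f) 1 = 1"
proof -
  let ?g = "local_inverse f"
  obtain s where s: "s > 0" "?g holomorphic_on ball 0 s" "?g 0 = 0"
      "\<And>w. w \<in> ball 0 s \<Longrightarrow> f (?g w) = w"
    using is_local_inverse_local_inverse[OF assms] unfolding is_local_inverse_def by blast
  have f: "(f has_field_derivative 1) (at (?g 0))"
    using assms s(3) holomorphic_derivI[of f "ball 0 1" 0] by (auto simp: class_A_def)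
  have g: "(?g has_field_derivative deriv ?g 0) (at 0)"
    using holomorphic_derivI[OF s(2), of 0] s(1) by simp
  have "((\<lambda>w. f (?g w)) has_field_derivative 1 * deriv ?g 0) (at 0)"
    using DERIV_chain2[OF f g] .
  then have "((\<lambda>w. w) has_field_derivative 1 * deriv ?g 0) (at 0)"
    by (rule has_field_derivative_transform_within_open[of _ _ _ "ball 0 s"]) (use s in auto)
  then have "deriv ?g 0 = 1" using DERIV_unique[OF _ DERIV_ident] by fastforce
  then show ?thesis by (simp add: taylor_coeff_def fps_expansion_def)
qed

end

theory Submission
  imports Defs
begin

text \<open>
  The condition on \<open>f\<close> says that \<open>z f'(z) / f(z) = 1 / (1 - w(z))\<close> for a Schwarz function
  \<open>w(z) = z \<phi>(z)\<close>. In the coefficients of \<open>w\<close> almost all terms of the Hankel determinant cancel: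
  \<open>144 H\<^sub>3(1) = 2 w\<^sub>1\<^sup>2 w\<^sub>2\<^sup>2 - 4 w\<^sub>1 w\<^sub>2 w\<^sub>3 - 9 w\<^sub>2\<^sup>3 + 18 w\<^sub>2 w\<^sub>4 - 16 w\<^sub>3\<^sup>2\<close>.
  One step of the Schur algorithm writes \<open>\<phi>\<close> through \<open>s = \<phi>(0)\<close> and another function \<open>\<psi>\<close> bounded by
  \<open>1\<close>, which pulls out the factor \<open>(1 - \<bar>s\<bar>\<^sup>2)\<^sup>2\<close>; the sharp bounds on the first three
  coefficients of \<open>\<psi>\<close> and the triangle inequality then suffice. Equality holds for \<open>w(z) = z\<^sup>3\<close>.
\<close>

section \<open>Functions bounded by 1 on the disc, and the Schur step\<close>

text \<open>The bound is not strict, so that unimodular constants belong to the class; they arise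
  whenever the Schwarz lemma holds with equality.\<close>

definition schur :: "(complex \<Rightarrow> complex) set" where
  "schur = {\<phi>. \<phi> holomorphic_on ball 0 1 \<and> (\<forall>z \<in> ball 0 1. cmod (\<phi> z) \<le> 1)}"

text \<open>Maximum modulus principle: the bound makes \<open>a\<close> an interior maximum of the
  norm, and \<open>1 - cmod a\<close> is the radius of the largest disc about \<open>a\<close>
  inside the unit disc.\<close>

lemma schur_constant:
  assumes "\<phi> \<in> schur" "a \<in> ball 0 1" "cmod (\<phi> a) = 1" "z \<in> ball 0 1"
  shows "\<phi> z = \<phi> a"
proof -
  have "\<phi> constant_on ball 0 1"
  proof (rule Schwarz2)
    show "\<phi> holomorphic_on ball 0 1" using assms by (simp add: schur_def)
    show "0 < 1 - cmod a" using assms(2) by simp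
    show sub: "ball a (1 - cmod a) \<subseteq> ball 0 1"
      by (simp add: ball_subset_ball_iff dist_norm)
    fix z assume "cmod (a - z) < 1 - cmod a"
    then have "z \<in> ball 0 1" using sub by (auto simp: dist_norm)
    then show "cmod (\<phi> z) \<le> cmod (\<phi> a)" using assms by (simp add: schur_def)
  qed
  then show ?thesis using assms(2,4) by (auto simp: constant_on_def)
qed

text \<open>Schwarz lemma under the closed bound: a value of norm \<open>1\<close> would make
  \<open>f\<close> constant by \<open>schur_constant\<close>, against \<open>f 0 = 0\<close>, so the
  strict bound assumed in \<open>Schwarz_Lemma\<close> holds.\<close>

lemma schwarz_quotient:
  assumes f: "f \<in> schur" "f 0 = 0"
  obtains h where "h \<in> schur" "\<And>z. z \<in> ball 0 1 \<Longrightarrow> f z = z * h z"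
proof -
  have hol: "f holomorphic_on ball 0 1" using f by (simp add: schur_def)
  have lt: "cmod (f z) < 1" if "cmod z < 1" for z
  proof (rule ccontr)
    assume "\<not> cmod (f z) < 1"
    then have 1: "cmod (f z) = 1" using f(1) that by (force simp: schur_def)
    then have "f 0 = f z" using schur_constant[OF f(1) _ 1, of 0] that by simp
    then show False using 1 f(2) by simp
  qed
  obtain h where h: "h holomorphic_on ball 0 1" "\<And>z. cmod z < 1 \<Longrightarrow> f z = z * h z" "deriv f 0 = h 0"
    using Schwarz3[OF hol f(2)] by blast
  have "cmod (h z) \<le> 1" if z: "cmod z < 1" for z
  proof (cases "z = 0")
    case True
    then show ?thesis using Schwarz_Lemma(2)[OF hol f(2) lt z] h(3) by simp
  next
    case False
    have "cmod z * cmod (h z) \<le> cmod z"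
      using Schwarz_Lemma(1)[OF hol f(2) lt z] h(2)[OF z] by (simp add: norm_mult)
    then show ?thesis using False by simp
  qed
  then have "h \<in> schur" using h(1) by (simp add: schur_def)
  then show ?thesis using that h(2) by simp
qed

text \<open>The squares of the two sides differ by \<open>(1 - |s|^2) * (1 - |u|^2)\<close>. The
  form without a quotient also covers a vanishing denominator.\<close>

lemma moebius_norm_le:
  assumes "cmod s \<le> 1" "cmod u \<le> 1"
  shows "cmod (u - s) \<le> cmod (1 - cnj s * u)"
proof -
  have "complex_of_real ((cmod (1 - cnj s * u))\<^sup>2 - (cmod (u - s))\<^sup>2)
      = complex_of_real ((1 - (cmod s)\<^sup>2) * (1 - (cmod u)\<^sup>2))"
    by (simp add: complex_norm_square algebra_simps del: of_real_power)
  then have "(cmod (1 - cnj s * u))\<^sup>2 - (cmod (u - s))\<^sup>2 = (1 - (cmod s)\<^sup>2) * (1 - (cmod u)\<^sup>2)"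
    using of_real_eq_iff by blast
  moreover have "0 \<le> (1 - (cmod s)\<^sup>2) * (1 - (cmod u)\<^sup>2)"
    using assms by (intro mult_nonneg_nonneg) (auto simp: power_le_one)
  ultimately have "(cmod (u - s))\<^sup>2 \<le> (cmod (1 - cnj s * u))\<^sup>2" by linarith
  then show ?thesis by (rule power2_le_imp_le) simp
qed

text \<open>In the boundary case \<open>cmod (\<phi> 0) = 1\<close> the function \<open>\<phi>\<close> is constant and \<open>\<psi> = 0\<close> works.\<close>
lemma schur_step:
  assumes \<phi>: "\<phi> \<in> schur"
  obtains \<psi> where "\<psi> \<in> schur"
    "\<And>z. z \<in> ball 0 1 \<Longrightarrow> \<phi> z = \<phi> 0 + z * \<psi> z * (1 - cnj (\<phi> 0) * \<phi> z)"
proof (cases "cmod (\<phi> 0) = 1")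
  case True
  show ?thesis
  proof (rule that)
    show "(\<lambda>_. 0) \<in> schur" by (simp add: schur_def)
    show "\<phi> z = \<phi> 0 + z * 0 * (1 - cnj (\<phi> 0) * \<phi> z)" if "z \<in> ball 0 1" for z
      using schur_constant[OF \<phi> _ True that] by simp
  qed
next
  case False
  let ?s = "\<phi> 0"
  have s: "cmod ?s < 1" and hol: "\<phi> holomorphic_on ball 0 1" and
    le: "\<And>z. z \<in> ball 0 1 \<Longrightarrow> cmod (\<phi> z) \<le> 1"
    using \<phi> False by (auto simp: schur_def order_less_le)
  have ne: "1 - cnj ?s * \<phi> z \<noteq> 0" if "z \<in> ball 0 1" for z
  proof -
    have "cmod (cnj ?s * \<phi> z) \<le> cmod ?s * 1"
      unfolding norm_mult complex_mod_cnj using le[OF that] by (intro mult_left_mono) auto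
    then show ?thesis using s by auto
  qed
  \<comment> \<open>The disc automorphism taking \<open>\<phi> 0\<close> to \<open>0\<close>,
    composed with \<open>\<phi>\<close>. Clearing the denominator in
    \<open>u z = z * \<psi> z\<close> gives the claimed relation.\<close>
  define u where "u z = (\<phi> z - ?s) / (1 - cnj ?s * \<phi> z)" for z
  have "u holomorphic_on ball 0 1"
    unfolding u_def using ne by (intro holomorphic_intros hol) auto
  moreover have "cmod (u z) \<le> 1" if "z \<in> ball 0 1" for z
    using moebius_norm_le[of ?s "\<phi> z"] le[OF that] s ne[OF that]
    by (simp add: u_def norm_divide divide_le_eq_1)
  ultimately have "u \<in> schur" by (simp add: schur_def)
  moreover have "u 0 = 0" by (simp add: u_def)
  ultimately obtain \<psi> where \<psi>: "\<psi> \<in> schur" "\<And>z. z \<in> ball 0 1 \<Longrightarrow> u z = z * \<psi> z"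
    using schwarz_quotient by blast
  have "\<phi> z = ?s + z * \<psi> z * (1 - cnj ?s * \<phi> z)" if "z \<in> ball 0 1" for z
    using \<psi>(2)[OF that] ne[OF that] by (simp add: u_def field_simps)
  then show ?thesis using that \<psi>(1) by blast
qed

section \<open>Taylor coefficients of functions bounded by 1\<close>

lemma has_fps_expansion_unit_ball:
  assumes "f holomorphic_on ball 0 1"
  shows "f has_fps_expansion fps_expansion f 0"
  using assms by (intro has_fps_expansion_fps_expansion[of "ball 0 1"]) auto

lemma fps_eqI_unit_ball:
  fixes f g :: "complex \<Rightarrow> complex"
  assumes "f has_fps_expansion F" "g has_fps_expansion G" "\<And>z. z \<in> ball 0 1 \<Longrightarrow> f z = g z"
  shows "F = G"
proof -
  have "eventually (\<lambda>z. z \<in> ball 0 1) (nhds (0::complex))"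
    by (intro eventually_nhds_in_open) auto
  then have "eventually (\<lambda>z. f z = g z) (nhds 0)"
    by eventually_elim (use assms(3) in blast)
  then have "f has_fps_expansion G"
    using assms(2) has_fps_expansion_cong by blast
  then show ?thesis using assms(1) fps_expansion_unique_complex by blast
qed

lemma taylor_coeff_0: "taylor_coeff f 0 = f 0"
  by (simp add: taylor_coeff_def fps_expansion_def)

text \<open>Coefficient comparison in the relation of \<open>schur_step\<close>. The lower
  \<open>b\<close> stay on the right-hand sides, which is the recursive form that
  \<open>hankel_poly_schur\<close> substitutes.\<close>

lemma schur_step_coeffs:
  assumes \<phi>: "\<phi> \<in> schur"
  defines "b \<equiv> taylor_coeff \<phi>"
  obtains \<psi> where "\<psi> \<in> schur"
    "b 1 = taylor_coeff \<psi> 0 * (1 - (cmod (b 0))\<^sup>2)"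
    "b 2 = taylor_coeff \<psi> 1 * (1 - (cmod (b 0))\<^sup>2) - cnj (b 0) * taylor_coeff \<psi> 0 * b 1"
    "b 3 = taylor_coeff \<psi> 2 * (1 - (cmod (b 0))\<^sup>2)
           - cnj (b 0) * (taylor_coeff \<psi> 1 * b 1 + taylor_coeff \<psi> 0 * b 2)"
proof -
  obtain \<psi> where \<psi>: "\<psi> \<in> schur"
    "\<And>z. z \<in> ball 0 1 \<Longrightarrow> \<phi> z = \<phi> 0 + z * \<psi> z * (1 - cnj (\<phi> 0) * \<phi> z)"
    using schur_step[OF \<phi>] by blast
  let ?s = "\<phi> 0"
  define B where "B = fps_expansion \<phi> 0"
  define C where "C = fps_expansion \<psi> 0"
  have B: "\<phi> has_fps_expansion B" and C: "\<psi> has_fps_expansion C"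
    using \<phi> \<psi>(1) by (auto simp: schur_def B_def C_def intro: has_fps_expansion_unit_ball)
  have "(\<lambda>z. ?s + z * \<psi> z * (1 - cnj ?s * \<phi> z)) has_fps_expansion
      fps_const ?s + fps_X * C * (1 - fps_const (cnj ?s) * B)"
    by (intro fps_expansion_intros B C)
  from fps_eqI_unit_ball[OF B this \<psi>(2)]
  have eq: "B = fps_const ?s + fps_X * (C * (1 - fps_const (cnj ?s) * B))"
    by (simp add: mult.assoc)
  have b: "b n = fps_nth B n" for n by (simp add: b_def B_def taylor_coeff_def)
  have c: "taylor_coeff \<psi> n = fps_nth C n" for n by (simp add: C_def taylor_coeff_def)
  have s: "?s = fps_nth B 0" using b[of 0] by (simp add: b_def taylor_coeff_0)
  \<comment> \<open>The factor \<open>fps_X\<close> makes coefficient \<open>Suc n\<close> of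
    \<open>B\<close> depend only on coefficients up to \<open>n\<close>.\<close>
  have rec: "fps_nth B (Suc n) = fps_nth (C * (1 - fps_const (cnj ?s) * B)) n" for n
    by (subst eq) simp
  have sq: "of_real (1 - (cmod (fps_nth B 0))\<^sup>2) = 1 - fps_nth B 0 * cnj (fps_nth B 0)"
    using complex_norm_square[of "fps_nth B 0"] by simp
  have 1: "b 1 = taylor_coeff \<psi> 0 * (1 - (cmod (b 0))\<^sup>2)"
    unfolding b c sq using rec[of 0] by (simp add: s algebra_simps)
  have 2: "b 2 = taylor_coeff \<psi> 1 * (1 - (cmod (b 0))\<^sup>2) - cnj (b 0) * taylor_coeff \<psi> 0 * b 1"
    unfolding b c sq using rec[of 1] by (simp add: s fps_mult_nth algebra_simps numeral_2_eq_2)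
  have 3: "b 3 = taylor_coeff \<psi> 2 * (1 - (cmod (b 0))\<^sup>2)
           - cnj (b 0) * (taylor_coeff \<psi> 1 * b 1 + taylor_coeff \<psi> 0 * b 2)"
    unfolding b c sq using rec[of 2]
    by (simp add: s fps_mult_nth algebra_simps numeral_2_eq_2 numeral_3_eq_3)
  show ?thesis by (rule that[OF \<psi>(1) 1 2 3])
qed

lemma schur_coeff_0_le: "\<phi> \<in> schur \<Longrightarrow> cmod (taylor_coeff \<phi> 0) \<le> 1"
  by (simp add: schur_def taylor_coeff_0)

text \<open>Schwarz-Pick at the origin: the Schur step writes the coefficient as
  \<open>1 - |\<phi> 0|^2\<close> times a value of norm at most \<open>1\<close>.\<close>

lemma schur_coeff_1_le:
  assumes "\<phi> \<in> schur"
  shows "cmod (taylor_coeff \<phi> 1) \<le> 1 - (cmod (taylor_coeff \<phi> 0))\<^sup>2"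
proof -
  let ?x = "cmod (taylor_coeff \<phi> 0)"
  obtain \<psi> where \<psi>: "\<psi> \<in> schur" "taylor_coeff \<phi> 1 = taylor_coeff \<psi> 0 * (1 - ?x\<^sup>2)"
    by (rule schur_step_coeffs[OF assms])
  have m: "0 \<le> 1 - ?x\<^sup>2" using schur_coeff_0_le[OF assms] by (simp add: power_le_one)
  have "cmod (taylor_coeff \<phi> 1) = cmod (taylor_coeff \<psi> 0) * (1 - ?x\<^sup>2)"
    unfolding \<psi>(2) norm_mult norm_of_real using m by simp
  also have "\<dots> \<le> 1 * (1 - ?x\<^sup>2)"
    using m schur_coeff_0_le[OF \<psi>(1)] by (intro mult_right_mono) auto
  finally show ?thesis by simp
qed

text \<open>Multiplied by \<open>1 + cmod (taylor_coeff \<phi> 0)\<close>, so that no division occurs.\<close>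
lemma schur_coeff_2_le:
  assumes "\<phi> \<in> schur"
  defines "p \<equiv> cmod (taylor_coeff \<phi> 0)" and "q \<equiv> cmod (taylor_coeff \<phi> 1)"
  shows "cmod (taylor_coeff \<phi> 2) * (1 + p) \<le> (1 - p\<^sup>2) * (1 + p) - q\<^sup>2"
proof -
  let ?b = "taylor_coeff \<phi>"
  obtain \<psi> where \<psi>: "\<psi> \<in> schur" "?b 1 = taylor_coeff \<psi> 0 * (1 - (cmod (?b 0))\<^sup>2)"
    "?b 2 = taylor_coeff \<psi> 1 * (1 - (cmod (?b 0))\<^sup>2) - cnj (?b 0) * taylor_coeff \<psi> 0 * ?b 1"
    by (rule schur_step_coeffs[OF assms(1)])
  define m where "m = 1 - p\<^sup>2"
  define d where "d = cmod (taylor_coeff \<psi> 0)"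
  have p: "0 \<le> p" "p \<le> 1" using schur_coeff_0_le[OF assms(1)] by (auto simp: p_def)
  then have m: "0 \<le> m" by (simp add: m_def power_le_one)
  have mc: "complex_of_real (1 - (cmod (?b 0))\<^sup>2) = of_real m" by (simp add: m_def p_def)
  have q: "q = d * m" using m unfolding q_def \<psi>(2) mc d_def norm_mult by simp
  have "cmod (?b 2) \<le> cmod (taylor_coeff \<psi> 1 * of_real m) + cmod (cnj (?b 0) * taylor_coeff \<psi> 0 * ?b 1)"
    unfolding \<psi>(3) mc by (rule norm_triangle_ineq4)
  also have "\<dots> = cmod (taylor_coeff \<psi> 1) * m + p * d * q"
    using m by (simp add: norm_mult p_def d_def q_def)
  \<comment> \<open>The bound on the first coefficient, applied to \<open>\<psi>\<close>.\<close>
  also have "\<dots> \<le> (1 - d\<^sup>2) * m + p * d * q"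
    using schur_coeff_1_le[OF \<psi>(1)] m by (intro add_right_mono mult_right_mono) (auto simp: d_def)
  finally have "cmod (?b 2) * (1 + p) \<le> ((1 - d\<^sup>2) * m + p * d * q) * (1 + p)"
    using p by (intro mult_right_mono) auto
  \<comment> \<open>With \<open>q = d * m\<close> the terms in \<open>d^2\<close> combine to
    \<open>- d^2 * m * (1 - p) * (1 + p) = - q^2\<close>.\<close>
  also have "\<dots> = (1 - p\<^sup>2) * (1 + p) - q\<^sup>2"
    unfolding q m_def by (simp add: algebra_simps power2_eq_square)
  finally show ?thesis .
qed

section \<open>The Hankel polynomial and its sharp bound\<close>

definition hankel_poly :: "complex \<Rightarrow> complex \<Rightarrow> complex \<Rightarrow> complex \<Rightarrow> complex" where
  "hankel_poly w1 w2 w3 w4 = 2 * w1\<^sup>2 * w2\<^sup>2 - 4 * w1 * w2 * w3 - 9 * w2 ^ 3 + 18 * w2 * w4 - 16 * w3\<^sup>2"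

text \<open>Each of \<open>b1\<close>, \<open>b2\<close>, \<open>b3\<close> is a multiple of
  \<open>m\<close>, and every monomial contains at least two of the last three arguments; hence the
  factor \<open>m^2\<close>. The terms from \<open>18 * w2 * w4\<close> and
  \<open>- 16 * w3^2\<close> nearly cancel: \<open>- 36 + 32 = - 4\<close> and
  \<open>18 - 16 = 2\<close>. This leaves coefficients small enough for a termwise estimate.\<close>

lemma hankel_poly_schur:
  fixes s c0 c1 c2 :: complex
  defines "m \<equiv> 1 - s * cnj s"
  defines "b1 \<equiv> c0 * m"
  defines "b2 \<equiv> c1 * m - cnj s * c0 * b1"
  defines "b3 \<equiv> c2 * m - cnj s * (c1 * b1 + c0 * b2)"
  shows "hankel_poly s b1 b2 b3 = m\<^sup>2 * (2 * s\<^sup>2 * c0\<^sup>2 - 4 * s * c0 * c1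
     + (13 * (s * cnj s) - 9) * c0 ^ 3 + 18 * c0 * c2 - 4 * cnj s * c0\<^sup>2 * c1
     + 2 * (cnj s)\<^sup>2 * c0 ^ 4 - 16 * c1\<^sup>2)"
  unfolding b3_def b2_def b1_def m_def hankel_poly_def by algebra

text \<open>The bracket is at most \<open>16 * (1 + x^2)\<close>, and
  \<open>(1 - x^2)^2 * (1 + x^2) \<le> 1\<close>. Equality occurs at \<open>x = p = 0\<close>,
  \<open>q = 1\<close>, the case of the extremal function.\<close>

lemma hankel_bound_real:
  fixes x p q r :: real
  assumes x: "0 \<le> x" "x \<le> 1" and p: "0 \<le> p" "p \<le> 1" and q: "0 \<le> q" "q \<le> 1 - p\<^sup>2"
    and r: "0 \<le> r" "r * (1 + p) \<le> (1 - p\<^sup>2) * (1 + p) - q\<^sup>2"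
  shows "(1 - x\<^sup>2)\<^sup>2 * (2 * x\<^sup>2 * p\<^sup>2 + 4 * x * p * q + 9 * p ^ 3 + 18 * p * r
      + 4 * x * p\<^sup>2 * q + 2 * x\<^sup>2 * p ^ 4 + 16 * q\<^sup>2) \<le> 16"
    (is "_ * ?S \<le> 16")
proof -
  have p1: "0 < 1 + p" using p by simp
  have q2: "q\<^sup>2 \<le> (1 - p\<^sup>2)\<^sup>2" using q by (intro power_mono) auto
  \<comment> \<open>\<open>16 q\<^sup>2 - 18 p q\<^sup>2 / (1 + p)\<close> is increasing in \<open>q\<close>, so \<open>q = 1 - p\<^sup>2\<close> is the worst case\<close>
  have "(18 * p * r + 16 * q\<^sup>2) * (1 + p) = 18 * p * (r * (1 + p)) + 16 * q\<^sup>2 * (1 + p)"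
    by (simp add: algebra_simps)
  also have "\<dots> \<le> 18 * p * ((1 - p\<^sup>2) * (1 + p) - q\<^sup>2) + 16 * q\<^sup>2 * (1 + p)"
    using r p by (intro add_right_mono mult_left_mono) auto
  also have "\<dots> = 18 * p * ((1 - p\<^sup>2) * (1 + p)) + (16 - 2 * p) * q\<^sup>2"
    by (simp add: algebra_simps)
  also have "\<dots> \<le> 18 * p * ((1 - p\<^sup>2) * (1 + p)) + (16 - 2 * p) * (1 - p\<^sup>2)\<^sup>2"
    using q2 p by (intro add_left_mono mult_left_mono) auto
  also have "\<dots> = (16 - 14 * p\<^sup>2 - 2 * p ^ 4) * (1 + p)" by algebra
  finally have A: "18 * p * r + 16 * q\<^sup>2 \<le> 16 - 14 * p\<^sup>2 - 2 * p ^ 4"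
    using p1 by (simp only: mult_le_cancel_right_pos)
  have "4 * x * p * q + 4 * x * p\<^sup>2 * q = 4 * (x * p) * ((1 + p) * q)"
    by (simp add: algebra_simps power2_eq_square)
  also have "\<dots> \<le> 4 * (x * p) * (5/4)"
  proof (intro mult_left_mono)
    have "(1 + p) * q \<le> (1 + p) * (1 - p\<^sup>2)" using q p by (intro mult_left_mono) auto
    \<comment> \<open>The maximum on the unit interval is \<open>32/27\<close>, attained at
      \<open>p = 1/3\<close>, which is the double root of the difference; \<open>5/4\<close> is a
      rounder upper bound.\<close>
    also have "(1 + p) * (1 - p\<^sup>2) = 32/27 - (p - 1/3)\<^sup>2 * (p + 5/3)"
      by (simp add: field_simps power2_eq_square)
    also have "\<dots> \<le> 5/4"
      using mult_nonneg_nonneg[of "(p - 1/3)\<^sup>2" "p + 5/3"] p zero_le_power2[of "p - 1/3"] by linarith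
    finally show "(1 + p) * q \<le> 5/4" .
  qed (use x p in auto)
  also have "\<dots> \<le> 5/2 * (x\<^sup>2 + p\<^sup>2)"
    using sum_squares_bound[of x p] by (simp add: field_simps)
  finally have B: "4 * x * p * q + 4 * x * p\<^sup>2 * q \<le> 5/2 * (x\<^sup>2 + p\<^sup>2)" .
  have C: "2 * x\<^sup>2 * p\<^sup>2 \<le> 2 * x\<^sup>2" "2 * x\<^sup>2 * p ^ 4 \<le> 2 * x\<^sup>2"
    using p by (auto intro!: mult_left_le power_le_one)
  have D: "p ^ 3 \<le> p\<^sup>2" using p by (intro power_decreasing) auto
  \<comment> \<open>The estimates add up to \<open>16 - 5/2 * p^2 - 2 * p^4 + 13/2 * x^2\<close>:
    the \<open>- 14 * p^2\<close> of \<open>A\<close> absorbs \<open>5/2 * p^2\<close> from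
    \<open>B\<close> and \<open>9 * p^2\<close> from \<open>D\<close>.\<close>
  have S: "?S \<le> 16 * (1 + x\<^sup>2)"
    using A B C D zero_le_power2[of p] zero_le_power2[of x] zero_le_power[OF p(1), of 4]
    unfolding distrib_left by linarith
  have m: "0 \<le> 1 - x\<^sup>2" "1 - x\<^sup>2 \<le> 1" using x by (auto simp: power_le_one)
  have "(1 - x\<^sup>2)\<^sup>2 * ?S \<le> (1 - x\<^sup>2)\<^sup>2 * (16 * (1 + x\<^sup>2))"
    using S by (intro mult_left_mono) auto
  also have "\<dots> = 16 * ((1 - x\<^sup>2) * (1 - (x\<^sup>2)\<^sup>2))" by algebra
  also have "\<dots> \<le> 16 * (1 * 1)"
    using m x by (intro mult_left_mono mult_mono) (auto simp: power_le_one)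
  finally show ?thesis by simp
qed

text \<open>Here \<open>b 0\<close>, ..., \<open>b 3\<close> play the role of \<open>w1\<close>,
  ..., \<open>w4\<close>, since \<open>w(z) = z * \<phi>(z)\<close>. After the factor
  \<open>m^2\<close> is extracted, the triangle inequality reduces the claim to
  \<open>hankel_bound_real\<close>.\<close>

lemma hankel_poly_schur_le:
  assumes "\<phi> \<in> schur"
  defines "b \<equiv> taylor_coeff \<phi>"
  shows "cmod (hankel_poly (b 0) (b 1) (b 2) (b 3)) \<le> 16"
proof -
  define s where "s = b 0"
  define x where "x = cmod s"
  obtain \<psi> where \<psi>: "\<psi> \<in> schur" "b 1 = taylor_coeff \<psi> 0 * (1 - (cmod (b 0))\<^sup>2)"
    "b 2 = taylor_coeff \<psi> 1 * (1 - (cmod (b 0))\<^sup>2) - cnj (b 0) * taylor_coeff \<psi> 0 * b 1"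
    "b 3 = taylor_coeff \<psi> 2 * (1 - (cmod (b 0))\<^sup>2)
           - cnj (b 0) * (taylor_coeff \<psi> 1 * b 1 + taylor_coeff \<psi> 0 * b 2)"
    unfolding b_def by (rule schur_step_coeffs[OF assms(1)])
  define c where "c = taylor_coeff \<psi>"
  define p where "p = cmod (c 0)"
  define q where "q = cmod (c 1)"
  define r where "r = cmod (c 2)"
  have x: "0 \<le> x" "x \<le> 1" using schur_coeff_0_le[OF assms(1)] by (auto simp: x_def s_def b_def)
  have p: "0 \<le> p" "p \<le> 1" using schur_coeff_0_le[OF \<psi>(1)] by (auto simp: p_def c_def)
  have q: "0 \<le> q" "q \<le> 1 - p\<^sup>2" using schur_coeff_1_le[OF \<psi>(1)] by (auto simp: p_def q_def c_def)
  have r: "0 \<le> r" "r * (1 + p) \<le> (1 - p\<^sup>2) * (1 + p) - q\<^sup>2"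
    using schur_coeff_2_le[OF \<psi>(1)] by (auto simp: p_def q_def r_def c_def)
  have ss: "of_real (1 - (cmod s)\<^sup>2) = 1 - s * cnj s" "s * cnj s = of_real (x\<^sup>2)"
    using complex_norm_square[of s] by (simp_all add: s_def x_def)
  let ?T = "2 * s\<^sup>2 * (c 0)\<^sup>2 - 4 * s * c 0 * c 1
     + (13 * (s * cnj s) - 9) * c 0 ^ 3 + 18 * c 0 * c 2 - 4 * cnj s * (c 0)\<^sup>2 * c 1
     + 2 * (cnj s)\<^sup>2 * c 0 ^ 4 - 16 * (c 1)\<^sup>2"
  have eq: "hankel_poly (b 0) (b 1) (b 2) (b 3) = (1 - s * cnj s)\<^sup>2 * ?T"
    unfolding \<psi>(2-4) s_def[symmetric] c_def[symmetric] ss(1)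
    by (rule hankel_poly_schur)
  have 1: "1 - s * cnj s = of_real (1 - x\<^sup>2)" using ss(2) by simp
  have 2: "13 * (s * cnj s) - 9 = of_real (13 * x\<^sup>2 - 9)" using ss(2) by simp
  \<comment> \<open>As \<open>x^2\<close> runs through the unit interval, the coefficient stays
    between \<open>-9\<close> and \<open>4\<close>.\<close>
  have "\<bar>13 * x\<^sup>2 - 9\<bar> \<le> 9" using x power_le_one[of x 2] zero_le_power2[of x] by linarith
  then have 3: "\<bar>13 * x\<^sup>2 - 9\<bar> * p ^ 3 \<le> 9 * p ^ 3" using p by (intro mult_right_mono) auto
  have "cmod ?T \<le> cmod (2 * s\<^sup>2 * (c 0)\<^sup>2) + cmod (4 * s * c 0 * c 1)
     + cmod ((13 * (s * cnj s) - 9) * c 0 ^ 3) + cmod (18 * c 0 * c 2) + cmod (4 * cnj s * (c 0)\<^sup>2 * c 1)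
     + cmod (2 * (cnj s)\<^sup>2 * c 0 ^ 4) + cmod (16 * (c 1)\<^sup>2)"
    by (intro norm_triangle_le norm_triangle_le_diff add_mono order_refl)
  also have "\<dots> = 2 * x\<^sup>2 * p\<^sup>2 + 4 * x * p * q + \<bar>13 * x\<^sup>2 - 9\<bar> * p ^ 3 + 18 * p * r
      + 4 * x * p\<^sup>2 * q + 2 * x\<^sup>2 * p ^ 4 + 16 * q\<^sup>2"
    unfolding 2 by (simp only: norm_mult norm_power norm_numeral norm_of_real complex_mod_cnj
      x_def[symmetric] p_def[symmetric] q_def[symmetric] r_def[symmetric])
  also have "\<dots> \<le> 2 * x\<^sup>2 * p\<^sup>2 + 4 * x * p * q + 9 * p ^ 3 + 18 * p * r
      + 4 * x * p\<^sup>2 * q + 2 * x\<^sup>2 * p ^ 4 + 16 * q\<^sup>2" (is "_ \<le> ?S")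
    using 3 by simp
  finally have T: "cmod ?T \<le> ?S" .
  have "cmod (hankel_poly (b 0) (b 1) (b 2) (b 3)) = (1 - x\<^sup>2)\<^sup>2 * cmod ?T"
    unfolding eq 1 norm_mult norm_power norm_of_real by simp
  also have "\<dots> \<le> (1 - x\<^sup>2)\<^sup>2 * ?S" using T by (intro mult_left_mono) auto
  also have "\<dots> \<le> 16" by (rule hankel_bound_real[OF x p q r])
  finally show ?thesis .
qed

section \<open>The determinant of the inverse in terms of the Schwarz function\<close>

text \<open>The assumptions on \<open>a2\<close>, ..., \<open>a5\<close> compare coefficients in
  \<open>f = z * f' * (1 - w)\<close>, those on \<open>A2\<close>, ..., \<open>A5\<close> in
  \<open>f (g z) = z\<close>. Both systems are triangular, so the \<open>a\<close> can be eliminated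
  by successive substitution.\<close>

lemma inverse_coeffs:
  fixes a2 a3 a4 a5 A2 A3 A4 A5 u1 u2 u3 u4 :: complex
  assumes a2: "a2 = u1" and a3: "2 * a3 = 2 * a2 * u1 + u2"
    and a4: "3 * a4 = 3 * a3 * u1 + 2 * a2 * u2 + u3"
    and a5: "4 * a5 = 4 * a4 * u1 + 3 * a3 * u2 + 2 * a2 * u3 + u4"
    and A2: "A2 = - a2" and A3: "A3 + 2 * a2 * A2 + a3 = 0"
    and A4: "A4 + a2 * (2 * A3 + A2\<^sup>2) + 3 * a3 * A2 + a4 = 0"
    and A5: "A5 + a2 * (2 * A4 + 2 * A2 * A3) + a3 * (3 * A3 + 3 * A2\<^sup>2) + 4 * a4 * A2 + a5 = 0"
  shows "A2 = - u1" "A3 = u1\<^sup>2 - u2 / 2" "A4 = - (u1 ^ 3) + 4 / 3 * u1 * u2 - u3 / 3"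
    "A5 = u1 ^ 4 - 29 / 12 * u1\<^sup>2 * u2 + 7 / 6 * u1 * u3 + 3 / 8 * u2\<^sup>2 - u4 / 4"
proof -
  have b3: "a3 = u1\<^sup>2 + u2 / 2"
    using a3 a2 by (simp add: field_simps power2_eq_square)
  have a4': "a4 = a3 * u1 + 2 / 3 * a2 * u2 + u3 / 3"
    using a4 by (simp add: field_simps)
  have b4: "a4 = u1 ^ 3 + u1 * u2 * 7 / 6 + u3 / 3"
    unfolding a4' b3 a2
    by (simp add: field_simps power2_eq_square power3_eq_cube power4_eq_xxxx)
  have b5: "a5 = a4 * u1 + 3 / 4 * a3 * u2 + a2 * u3 / 2 + u4 / 4"
    using a5 by (simp add: field_simps)
  show B2: "A2 = - u1" using A2 a2 by simp
  have A3': "A3 = - (2 * a2 * A2 + a3)"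
    using A3 by (simp only: add.assoc add_eq_0_iff2)
  show B3: "A3 = u1\<^sup>2 - u2 / 2"
    unfolding A3' B2 b3 a2
    by (simp add: field_simps power2_eq_square power3_eq_cube power4_eq_xxxx)
  have A4': "A4 = - (a2 * (2 * A3 + A2\<^sup>2) + 3 * a3 * A2 + a4)"
    using A4 by (simp only: add.assoc add_eq_0_iff2)
  show B4: "A4 = - (u1 ^ 3) + 4 / 3 * u1 * u2 - u3 / 3"
    unfolding A4' B2 B3 b3 b4 a2
    by (simp add: field_simps power2_eq_square power3_eq_cube power4_eq_xxxx)
  have A5': "A5 = - (a2 * (2 * A4 + 2 * A2 * A3) + a3 * (3 * A3 + 3 * A2\<^sup>2)
      + 4 * a4 * A2 + a5)"
    using A5 by (simp only: add.assoc add_eq_0_iff2)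
  show B5: "A5 = u1 ^ 4 - 29 / 12 * u1\<^sup>2 * u2 + 7 / 6 * u1 * u3 + 3 / 8 * u2\<^sup>2 - u4 / 4"
    unfolding A5' b5 B2 B3 B4 b3 b4 a2
    by (simp add: field_simps power2_eq_square power3_eq_cube power4_eq_xxxx)
qed

text \<open>\<open>144\<close> is the common denominator of the surviving coefficients
  \<open>1/72\<close>, \<open>1/36\<close>, \<open>1/16\<close>, \<open>1/8\<close> and
  \<open>1/9\<close>.\<close>

lemma hankel_det_eq:
  fixes u1 u2 u3 u4 :: complex
  defines "A2 \<equiv> - u1" and "A3 \<equiv> u1\<^sup>2 - u2 / 2"
    and "A4 \<equiv> - (u1 ^ 3) + 4 / 3 * u1 * u2 - u3 / 3"
    and "A5 \<equiv> u1 ^ 4 - 29 / 12 * u1\<^sup>2 * u2 + 7 / 6 * u1 * u3 + 3 / 8 * u2\<^sup>2 - u4 / 4"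
  shows "det (vector [vector [1, A2, A3], vector [A2, A3, A4], vector [A3, A4, A5]] :: complex ^ 3 ^ 3)
    = hankel_poly u1 u2 u3 u4 / 144"
  unfolding det_3 vector_3 A2_def A3_def A4_def A5_def hankel_poly_def by algebra

text \<open>No bound on \<open>w\<close> enters, as this is pure coefficient algebra; it serves both
  the estimate and the extremal function. The equation without quotients is meaningful at
  \<open>0\<close> too.\<close>

lemma hankel3_local_inverse:
  assumes f: "f \<in> class_A" and w: "w holomorphic_on ball 0 1" "w 0 = 0"
    and eq: "\<And>z. z \<in> ball 0 1 \<Longrightarrow> f z = z * deriv f z * (1 - w z)"
  defines "c \<equiv> taylor_coeff w"
  shows "hankel3 (local_inverse f) = hankel_poly (c 1) (c 2) (c 3) (c 4) / 144"
proof -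
  define g where "g = local_inverse f"
  define F where "F = fps_expansion f 0"
  define G where "G = fps_expansion g 0"
  define W where "W = fps_expansion w 0"
  have F: "f has_fps_expansion F" and W: "w has_fps_expansion W"
    using f w by (auto simp: class_A_def F_def W_def intro: has_fps_expansion_unit_ball)
  obtain r where r: "r > 0" "g holomorphic_on ball 0 r" "g 0 = 0"
      "\<And>z. z \<in> ball 0 r \<Longrightarrow> f (g z) = z"
    using is_local_inverse_local_inverse[OF f] unfolding is_local_inverse_def g_def by blast
  have G: "g has_fps_expansion G"
    unfolding G_def using r by (intro has_fps_expansion_fps_expansion[of "ball 0 r"]) auto
  have G0: "fps_nth G 0 = 0" and W0: "fps_nth W 0 = 0" and F0: "fps_nth F 0 = 0"
    and F1: "fps_nth F (Suc 0) = 1"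
    using r(3) w(2) f by (simp_all add: G_def W_def F_def fps_expansion_def class_A_def)
  have G1: "fps_nth G (Suc 0) = 1"
    using taylor_coeff_local_inverse_1[OF f] by (simp add: taylor_coeff_def G_def g_def)
  have "F = fps_X * fps_deriv F * (1 - W)"
    by (rule fps_eqI_unit_ball[OF F _ eq]) (intro fps_expansion_intros F W)
  then have FW: "fps_nth F n = fps_nth (fps_X * (fps_deriv F * (1 - W))) n" for n
    by (simp add: mult.assoc)
  have "eventually (\<lambda>z. z \<in> ball 0 r) (nhds (0::complex))"
    using r(1) by (intro eventually_nhds_in_open) auto
  then have "eventually (\<lambda>z. (f \<circ> g) z = z) (nhds 0)"
    by eventually_elim (use r(4) in simp)
  then have "(f \<circ> g) has_fps_expansion fps_X"
    using has_fps_expansion_cong[of "f \<circ> g" "\<lambda>z. z" fps_X fps_X] has_fps_expansion_fps_X by blast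
  \<comment> \<open>Formal composition matches composition of functions because \<open>G\<close> has
    constant term \<open>0\<close>.\<close>
  then have "fps_compose F G = fps_X"
    using has_fps_expansion_compose[OF F G G0] fps_expansion_unique_complex by blast
  then have FG: "(\<Sum>i=0..n. fps_nth F i * fps_nth (G ^ i) n) = fps_nth fps_X n" for n
    by (metis fps_compose_nth)
  define a where "a n = fps_nth F n" for n
  define A where "A n = fps_nth G n" for n
  define u where "u n = fps_nth W n" for n
  note nums = eval_nat_numeral fps_mult_nth G0 W0 F0 F1 G1
  have a2: "a 2 = u 1" using FW[of 2]
    by (simp add: nums a_def u_def)
  have a3: "2 * a 3 = 2 * a 2 * u 1 + u 2" using FW[of 3]
    by (simp add: nums a_def u_def algebra_simps)
  have a4: "3 * a 4 = 3 * a 3 * u 1 + 2 * a 2 * u 2 + u 3" using FW[of 4]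
    by (simp add: nums a_def u_def algebra_simps)
  have a5: "4 * a 5 = 4 * a 4 * u 1 + 3 * a 3 * u 2 + 2 * a 2 * u 3 + u 4" using FW[of 5]
    by (simp add: nums a_def u_def algebra_simps)
  have A2: "A 2 = - a 2" using FG[of 2]
    by (simp add: nums A_def a_def add_eq_0_iff)
  have A3: "A 3 + 2 * a 2 * A 2 + a 3 = 0" using FG[of 3]
    by (simp add: nums A_def a_def algebra_simps)
  have A4: "A 4 + a 2 * (2 * A 3 + (A 2)\<^sup>2) + 3 * a 3 * A 2 + a 4 = 0" using FG[of 4]
    by (simp add: nums A_def a_def algebra_simps)
  have A5: "A 5 + a 2 * (2 * A 4 + 2 * A 2 * A 3) + a 3 * (3 * A 3 + 3 * (A 2)\<^sup>2)
      + 4 * a 4 * A 2 + a 5 = 0" using FG[of 5]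
    by (simp add: nums A_def a_def algebra_simps)
  note A = inverse_coeffs[OF a2 a3 a4 a5 A2 A3 A4 A5]
  have A1: "A 1 = 1" using G1 by (simp add: A_def)
  have tc: "taylor_coeff g n = A n" "c n = u n" for n
    by (simp_all add: taylor_coeff_def A_def G_def c_def u_def W_def)
  show ?thesis
    unfolding g_def[symmetric] hankel3_def Let_def tc A1 A by (rule hankel_det_eq)
qed

section \<open>From starlike functions to Schwarz functions\<close>

text \<open>The map \<open>(h - 1) / h\<close> takes the half plane \<open>Re h > 1/2\<close> onto
  the unit disc; with \<open>h = z * f' / f\<close> this gives
  \<open>w = 1 - f / (z * f')\<close>.\<close>

lemma starlike_half_schwarz:
  assumes "f \<in> starlike_half"
  obtains w where "w \<in> schur" "w 0 = 0"
    "\<And>z. z \<in> ball 0 1 \<Longrightarrow> f z = z * deriv f z * (1 - w z)"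
proof -
  have hol: "f holomorphic_on ball 0 1" and f0: "f 0 = 0" and d0: "deriv f 0 = 1"
    using assms by (auto simp: starlike_half_def class_A_def)
  have re: "f z \<noteq> 0" "Re (z * deriv f z / f z) > 1/2" if "z \<in> ball 0 1" "z \<noteq> 0" for z
    using assms that by (auto simp: starlike_half_def)
  have ne: "deriv f z \<noteq> 0" if "z \<in> ball 0 1" for z
    using re(2)[OF that] d0 by (cases "z = 0") auto
  \<comment> \<open>\<open>k\<close> extends \<open>f z / z\<close> holomorphically across
    \<open>0\<close>, so that \<open>w\<close> needs no separate treatment there.\<close>
  obtain k where k: "k holomorphic_on ball 0 1" "\<And>z. cmod z < 1 \<Longrightarrow> f z = z * k z" "deriv f 0 = k 0"
    using Schwarz3[OF hol f0] by blast
  define w where "w z = 1 - k z / deriv f z" for z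
  have w0: "w 0 = 0" using k(3) d0 by (simp add: w_def)
  have "w holomorphic_on ball 0 1"
    unfolding w_def using ne by (intro holomorphic_intros k(1) holomorphic_deriv[OF hol]) auto
  moreover have "cmod (w z) \<le> 1" if z: "z \<in> ball 0 1" for z
  proof (cases "z = 0")
    case False
    let ?h = "z * deriv f z / f z"
    have h: "Re ?h > 1/2" using re(2)[OF z False] .
    then have h0: "?h \<noteq> 0" by auto
    have "w z = (?h - 1) / ?h"
      using re(1)[OF z False] ne[OF z] False k(2)[of z] z by (simp add: w_def field_simps)
    then have "cmod (w z) = cmod (?h - 1) / cmod ?h" by (simp only: norm_divide)
    moreover have "cmod (?h - 1) \<le> cmod ?h"
    proof (rule power2_le_imp_le)
      \<comment> \<open>\<open>|h|^2 - |h - 1|^2 = 2 * Re h - 1\<close>.\<close>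
      show "(cmod (?h - 1))\<^sup>2 \<le> (cmod ?h)\<^sup>2"
        using h unfolding cmod_power2 by (simp add: power2_eq_square algebra_simps)
    qed simp
    moreover have "0 < cmod ?h" by (rule zero_less_norm_iff[THEN iffD2, OF h0])
    ultimately show ?thesis by (simp only: divide_le_eq_1_pos)
  qed (simp add: w0)
  ultimately have "w \<in> schur" by (simp add: schur_def)
  moreover have "f z = z * deriv f z * (1 - w z)" if "z \<in> ball 0 1" for z
    using k(2)[of z] ne[OF that] that by (simp add: w_def)
  ultimately show ?thesis using that w0 by blast
qed

lemma hankel3_starlike_half_le:
  assumes "f \<in> starlike_half"
  shows "cmod (hankel3 (local_inverse f)) \<le> 1/9"
proof -
  obtain w where w: "w \<in> schur" "w 0 = 0"
    "\<And>z. z \<in> ball 0 1 \<Longrightarrow> f z = z * deriv f z * (1 - w z)"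
    using starlike_half_schwarz[OF assms] by blast
  obtain \<phi> where \<phi>: "\<phi> \<in> schur" "\<And>z. z \<in> ball 0 1 \<Longrightarrow> w z = z * \<phi> z"
    using schwarz_quotient[OF w(1,2)] by blast
  have hol: "w holomorphic_on ball 0 1" "\<phi> holomorphic_on ball 0 1"
    using w(1) \<phi>(1) by (simp_all add: schur_def)
  have "fps_expansion w 0 = fps_X * fps_expansion \<phi> 0"
  proof (rule fps_eqI_unit_ball)
    show "w has_fps_expansion fps_expansion w 0"
      by (intro has_fps_expansion_unit_ball hol)
    show "(\<lambda>z. z * \<phi> z) has_fps_expansion fps_X * fps_expansion \<phi> 0"
      by (intro fps_expansion_intros has_fps_expansion_unit_ball hol)
  qed (use \<phi>(2) in blast)
  \<comment> \<open>Division by \<open>z\<close> shifts indices: the coefficients \<open>1\<close>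
    to \<open>4\<close> of \<open>w\<close> are the coefficients \<open>0\<close> to
    \<open>3\<close> of \<open>\<phi>\<close>.\<close>
  then have c: "taylor_coeff w (Suc n) = taylor_coeff \<phi> n" for n
    by (simp add: taylor_coeff_def)
  have f: "f \<in> class_A" using assms by (simp add: starlike_half_def)
  have "hankel3 (local_inverse f)
      = hankel_poly (taylor_coeff \<phi> 0) (taylor_coeff \<phi> 1) (taylor_coeff \<phi> 2) (taylor_coeff \<phi> 3) / 144"
    using hankel3_local_inverse[OF f hol(1) w(2,3)] c[of 0] c[of 1] c[of 2] c[of 3]
    by (simp add: eval_nat_numeral)
  then have "cmod (hankel3 (local_inverse f)) = cmod (hankel_poly (taylor_coeff \<phi> 0)
      (taylor_coeff \<phi> 1) (taylor_coeff \<phi> 2) (taylor_coeff \<phi> 3)) / 144"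
    by (simp only: norm_divide norm_numeral)
  then show ?thesis using hankel_poly_schur_le[OF \<phi>(1)] by linarith
qed

section \<open>Sharpness\<close>

text \<open>Here \<open>z * f' / f = 1 / (1 - z^3)\<close>, so the Schwarz function is
  \<open>z^3\<close>. Only \<open>w3 = 1\<close> survives, and the determinant is
  \<open>- 16 / 144\<close>.\<close>

lemma extremal_function:
  defines "f \<equiv> \<lambda>z::complex. z / (1 - z ^ 3) powr (1/3)"
  shows "f \<in> starlike_half" and "cmod (hankel3 (local_inverse f)) = 1/9"
proof -
  have z3: "cmod (z ^ 3) < 1" if "z \<in> ball 0 1" for z :: complex
    using that power_Suc_less_one[of "cmod z" 2] by (cases "z = 0") (auto simp: norm_power)
  have pos: "Re (1 - z ^ 3) > 0" if "z \<in> ball 0 1" for z :: complex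
    using z3[OF that] complex_Re_le_cmod[of "z ^ 3"] by simp
  have np: "1 - z ^ 3 \<notin> \<real>\<^sub>\<le>\<^sub>0" "1 - z ^ 3 \<noteq> 0" if "z \<in> ball 0 1" for z :: complex
    using pos[OF that] by (auto simp: complex_nonpos_Reals_iff)
  have der: "(f has_field_derivative (1 / (1 - z ^ 3) powr (1/3) / (1 - z ^ 3))) (at z)"
    if z: "z \<in> ball 0 1" for z
  proof -
    let ?p = "(1 - z ^ 3) powr (1/3)"
    have "((\<lambda>z. 1 - z ^ 3) has_field_derivative - 3 * z\<^sup>2) (at z)"
      by (auto intro!: derivative_eq_intros)
    from DERIV_chain2[OF has_field_derivative_powr[OF np(1)[OF z], of "1/3"] this]
    have "((\<lambda>z. (1 - z ^ 3) powr (1/3)) has_field_derivative - z\<^sup>2 * ?p / (1 - z ^ 3)) (at z)"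
      using powr_diff[of "1 - z ^ 3" "1/3" 1] by (simp add: mult_ac)
    then have "(f has_field_derivative
        (1 * ?p - z * (- z\<^sup>2 * ?p / (1 - z ^ 3))) / (?p * ?p)) (at z)"
      unfolding f_def using np[OF z] by (intro DERIV_divide DERIV_ident) auto
    moreover have "(1 * ?p - z * (- z\<^sup>2 * ?p / (1 - z ^ 3))) / (?p * ?p) = 1 / ?p / (1 - z ^ 3)"
      using np(2)[OF z] by (simp add: divide_simps) (simp add: algebra_simps power2_eq_square power3_eq_cube)
    ultimately show ?thesis by simp
  qed
  then have hol: "f holomorphic_on ball 0 1"
    using holomorphic_on_open by blast
  have d: "deriv f z = 1 / (1 - z ^ 3) powr (1/3) / (1 - z ^ 3)" if "z \<in> ball 0 1" for z
    using der[OF that] DERIV_imp_deriv by blast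
  have A: "f \<in> class_A" using hol d[of 0] by (simp add: class_A_def f_def)
  have "f z \<noteq> 0 \<and> Re (z * deriv f z / f z) > 1/2" if z: "z \<in> ball 0 1 - {0}" for z
  proof
    have zb: "z \<in> ball 0 1" using z by simp
    show fz: "f z \<noteq> 0" using np[OF zb] z by (simp add: f_def)
    have "z * deriv f z / f z = 1 / (1 - z ^ 3)"
      using np[OF zb] z unfolding d[OF zb] by (simp add: f_def field_simps)
    moreover have "Re (1 / (1 - z ^ 3)) > 1/2"
    proof -
      \<comment> \<open>For \<open>v = 1 - z^3\<close>, the claim \<open>Re (1 / v) > 1/2\<close>
        amounts to \<open>|v|^2 < 2 * Re v\<close>, that is, to \<open>|1 - v| < 1\<close>.\<close>
      have "(cmod (z ^ 3))\<^sup>2 < 1" using z3[OF zb] by (simp add: power_less_one_iff abs_square_less_1)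
      then have "(cmod (1 - z ^ 3))\<^sup>2 < 2 * Re (1 - z ^ 3)"
        unfolding cmod_power2 by (simp add: power2_eq_square algebra_simps)
      moreover have "(cmod (1 - z ^ 3))\<^sup>2 > 0" using np[OF zb] by simp
      ultimately show ?thesis
        by (simp add: Re_divide' cmod_power2[symmetric] field_simps)
    qed
    ultimately show "Re (z * deriv f z / f z) > 1/2" by simp
  qed
  then show "f \<in> starlike_half" using A by (simp add: starlike_half_def)
  have "fps_expansion (\<lambda>z::complex. z ^ 3) 0 = fps_X ^ 3"
    by (intro fps_expansion_eqI fps_expansion_intros)
  then have c: "taylor_coeff (\<lambda>z. z ^ 3) n = (if n = 3 then 1 else 0)" for n
    by (simp add: taylor_coeff_def fps_X_power_nth)
  have "hankel3 (local_inverse f) = hankel_poly 0 0 1 0 / 144"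
    using hankel3_local_inverse[OF A, of "\<lambda>z. z ^ 3"] np(2)
    by (simp add: c d holomorphic_intros) (simp add: f_def)
  then show "cmod (hankel3 (local_inverse f)) = 1/9"
    by (simp add: hankel_poly_def)
qed

theorem theorem2p1:
  shows "(\<forall>f \<in> starlike_half. cmod (hankel3 (local_inverse f)) \<le> 1/9) \<and>
         (let f\<^sub>0 = (\<lambda>z::complex. z / (1 - z ^ 3) powr (1/3)) in
            f\<^sub>0 \<in> starlike_half \<and> cmod (hankel3 (local_inverse f\<^sub>0)) = 1/9)"
  unfolding Let_def by (intro conjI ballI hankel3_starlike_half_le extremal_function)

end
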